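(* Let $n\in\omega$, $n\geq 2$, let $X$ be an $n$-Hausdorff space and let $Y=n\text{-}\kappa X$ be the $n$-H-closed extension of $X$ described in the context. Let $f:Y\to Y$ be a continuous surjection such that $f(x)=x$ for all $x\in X$. Then $f$ is a homeomorphism.
   Context: Spaces are arbitrary topological spaces. A space $X$ is $n$-Hausdorff if for any distinct points $x_1,\dots,x_n\in X$ there are open sets $U_i\ni x_i$ with $\bigcap_{i=1}^n U_i=\varnothing$. An $n$-Hausdorff space is $n$-H-closed if it is closed in every $n$-Hausdorff space in which it is embedded. An extension of $X$ is a space containing $X$ as a dense subspace. An open filter on $X$ is a nonempty family of nonempty open subsets closed under finite intersections and open supersets; an open ultrafilter is a maximal open filter. The adherence of $\mathcal F$ is $a\mathcal F=\bigcap_{F\in\mathcal F}\mathrm{cl}_X(F)$. Construction of $n\text{-}\kappa X$: let $\{\mathcal U_\alpha:\alpha\in|\mathfrak U|\}$ be a one-to-one indexing of the set $\mathfrak U$ of all open ultrafilters $\mathcal U$ on $X$ with $|a\mathcal U|<n-1$. For each $\alpha$ let $k\alpha=n-1-|a\mathcal U_\alpha|$ and let $p_{\alpha i}$ ($1\leq i\leq k\alpha$) be points, all distinct (over all $\alpha,i$) and not in $X$. Put $Y=X\cup\{p_{\alpha i}:\alpha\in|\mathfrak U|,\,1\leq i\leq k\alpha\}$. A set $V\subseteq Y$ is open iff $V\cap X$ is open in $X$ and, whenever $p_{\alpha i}\in V$, $V\cap X\in\mathcal U_\alpha$. This $Y$ is an $n$-H-closed extension of $X$. *)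

theory Defs
  imports "HOL-Analysis.Abstract_Topology"
begin

definition n_Hausdorff :: "nat \<Rightarrow> 'a topology \<Rightarrow> bool" where
  "n_Hausdorff n X \<longleftrightarrow>
    (\<forall>x :: nat \<Rightarrow> 'a. inj_on x {1..n} \<and> x ` {1..n} \<subseteq> topspace X \<longrightarrow>
      (\<exists>U. (\<forall>i\<in>{1..n}. openin X (U i) \<and> x i \<in> U i) \<and> (\<Inter>i\<in>{1..n}. U i) = {}))"

definition open_filter :: "'a topology \<Rightarrow> 'a set set \<Rightarrow> bool" where
  "open_filter X \<F> \<longleftrightarrow>
    \<F> \<noteq> {} \<and>
    (\<forall>F\<in>\<F>. openin X F \<and> F \<noteq> {}) \<and>
    (\<forall>F\<in>\<F>. \<forall>G\<in>\<F>. F \<inter> G \<in> \<F>) \<and>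
    (\<forall>F\<in>\<F>. \<forall>G. openin X G \<and> F \<subseteq> G \<longrightarrow> G \<in> \<F>)"

definition open_ultrafilter :: "'a topology \<Rightarrow> 'a set set \<Rightarrow> bool" where
  "open_ultrafilter X \<U> \<longleftrightarrow>
    open_filter X \<U> \<and> (\<forall>\<G>. open_filter X \<G> \<and> \<U> \<subseteq> \<G> \<longrightarrow> \<G> = \<U>)"

definition adherence :: "'a topology \<Rightarrow> 'a set set \<Rightarrow> 'a set" where
  "adherence X \<F> = (\<Inter>F\<in>\<F>. X closure_of F)"

text \<open>Finiteness is explicit because \<^const>\<open>card\<close> is 0 on infinite sets.\<close>

definition small_ultrafilters :: "nat \<Rightarrow> 'a topology \<Rightarrow> 'a set set set" where
  "small_ultrafilters n X =
    {\<U>. open_ultrafilter X \<U> \<and> finite (adherence X \<U>) \<and> card (adherence X \<U>) < n - 1}"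

text \<open>The ultrafilters index themselves: the \<open>i\<close>-th point added for \<open>\<U>\<close> is \<open>Inr (\<U>, i)\<close>,
  and \<open>X\<close> sits inside the extension via \<^const>\<open>Inl\<close>, so that the trace on \<open>X\<close> of a set \<open>V\<close>
  of points of the extension is \<open>Inl -` V\<close>.\<close>

type_synonym 'a kappa_point = "'a + 'a set set \<times> nat"

definition n_kappa_points :: "nat \<Rightarrow> 'a topology \<Rightarrow> 'a kappa_point set" where
  "n_kappa_points n X =
    Inl ` topspace X \<union>
    {Inr (\<U>, i) | \<U> i. \<U> \<in> small_ultrafilters n X \<and> 1 \<le> i \<and> i \<le> n - 1 - card (adherence X \<U>)}"

definition n_kappa :: "nat \<Rightarrow> 'a topology \<Rightarrow> 'a kappa_point topology" where
  "n_kappa n X = topology (\<lambda>V. V \<subseteq> n_kappa_points n X \<and> openin X (Inl -` V) \<and>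
    (\<forall>\<U> i. Inr (\<U>, i) \<in> V \<longrightarrow> Inl -` V \<in> \<U>))"

lemma small_ultrafilters_open_filter:
  "\<U> \<in> small_ultrafilters n X \<Longrightarrow> open_filter X \<U>"
  by (simp add: small_ultrafilters_def open_ultrafilter_def)

lemma Inr_in_n_kappa_points:
  "Inr (\<U>, i) \<in> n_kappa_points n X \<longleftrightarrow>
    \<U> \<in> small_ultrafilters n X \<and> 1 \<le> i \<and> i \<le> n - 1 - card (adherence X \<U>)"
  by (auto simp: n_kappa_points_def)

lemma Inl_in_n_kappa_points: "Inl x \<in> n_kappa_points n X \<longleftrightarrow> x \<in> topspace X"
  by (auto simp: n_kappa_points_def)

lemma openin_n_kappa:
  "openin (n_kappa n X) V \<longleftrightarrow> V \<subseteq> n_kappa_points n X \<and> openin X (Inl -` V) \<and>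
    (\<forall>\<U> i. Inr (\<U>, i) \<in> V \<longrightarrow> Inl -` V \<in> \<U>)"
proof -
  let ?P = "\<lambda>V. V \<subseteq> n_kappa_points n X \<and> openin X (Inl -` V) \<and>
    (\<forall>\<U> i. Inr (\<U>, i) \<in> V \<longrightarrow> Inl -` V \<in> \<U>)"
  have filt: "open_filter X \<U>" if "?P V" "Inr (\<U>, i) \<in> V" for V \<U> i
    using that small_ultrafilters_open_filter Inr_in_n_kappa_points by blast
  have Int: "?P (S \<inter> T)" if S: "?P S" and T: "?P T" for S T
  proof (intro conjI allI impI)
    show "S \<inter> T \<subseteq> n_kappa_points n X" using S by blast
    show "openin X (Inl -` (S \<inter> T))" using S T by (simp add: openin_Int)
    fix \<U> i assume p: "Inr (\<U>, i) \<in> S \<inter> T"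
    then have "open_filter X \<U>" using filt[OF S] by blast
    moreover have "Inl -` S \<in> \<U>" "Inl -` T \<in> \<U>" using S T p by blast+
    ultimately show "Inl -` (S \<inter> T) \<in> \<U>" unfolding open_filter_def vimage_Int by metis
  qed
  have Un: "?P (\<Union>\<K>)" if K: "\<forall>V\<in>\<K>. ?P V" for \<K>
  proof (intro conjI allI impI)
    show "\<Union>\<K> \<subseteq> n_kappa_points n X" using K by blast
    show op: "openin X (Inl -` \<Union>\<K>)" using K unfolding vimage_Union by (intro openin_Union) auto
    fix \<U> i assume "Inr (\<U>, i) \<in> \<Union>\<K>"
    then obtain V where V: "V \<in> \<K>" "Inr (\<U>, i) \<in> V" by blast
    from filt[OF bspec[OF K V(1)] V(2)] have "open_filter X \<U>" .
    moreover have "Inl -` V \<in> \<U>" using K V by metis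
    moreover have "Inl -` V \<subseteq> Inl -` \<Union>\<K>" using V by blast
    ultimately show "Inl -` \<Union>\<K> \<in> \<U>" using op unfolding open_filter_def by metis
  qed
  have "istopology ?P"
    unfolding istopology_def
    by (rule conjI, rule allI, rule allI, rule impI, rule impI, erule Int, assumption,
        rule allI, rule impI, erule Un)
  then show ?thesis unfolding n_kappa_def by (rule fun_cong[OF topology_inverse'])
qed

lemma topspace_n_kappa: "topspace (n_kappa n X) = n_kappa_points n X"
proof -
  have v: "Inl -` n_kappa_points n X = topspace X"
    by (auto simp: Inl_in_n_kappa_points)
  have "topspace X \<in> \<U>" if "Inr (\<U>, i) \<in> n_kappa_points n X" for \<U> i
  proof -
    have "open_filter X \<U>"
      using that small_ultrafilters_open_filter Inr_in_n_kappa_points by blast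
    then obtain F where "F \<in> \<U>" "F \<subseteq> topspace X"
      unfolding open_filter_def by (meson ex_in_conv openin_subset)
    then show ?thesis using \<open>open_filter X \<U>\<close> unfolding open_filter_def by blast
  qed
  then have "openin (n_kappa n X) (n_kappa_points n X)"
    by (auto simp: openin_n_kappa v)
  then show ?thesis
    using openin_n_kappa[of n X "topspace (n_kappa n X)"] openin_subset openin_topspace
    by (metis subset_antisym)
qed

lemma embedding_map_n_kappa:
  fixes X :: "'a topology"
  shows "embedding_map X (n_kappa n X) Inl"
proof -
  have "open_map X (n_kappa n X) Inl"
    unfolding open_map_def
  proof (intro allI impI)
    fix U assume U: "openin X U"
    have v: "Inl -` (Inl ` U :: 'a kappa_point set) = U" by blast
    have "Inl ` U \<subseteq> n_kappa_points n X"
      using openin_subset[OF U] by (auto simp: Inl_in_n_kappa_points)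
    then show "openin (n_kappa n X) (Inl ` U)"
      using U by (auto simp: openin_n_kappa v)
  qed
  moreover have "continuous_map X (n_kappa n X) Inl"
    unfolding continuous_map_def
  proof (intro conjI allI impI)
    show "Inl \<in> topspace X \<rightarrow> topspace (n_kappa n X)"
      by (auto simp: topspace_n_kappa n_kappa_points_def)
    fix U assume U: "openin (n_kappa n X) U"
    then have "openin X (Inl -` U)" by (simp add: openin_n_kappa)
    moreover have "{x \<in> topspace X. Inl x \<in> U} = Inl -` U"
      using openin_subset[OF calculation] by blast
    ultimately show "openin X {x \<in> topspace X. Inl x \<in> U}" by simp
  qed
  ultimately show ?thesis by (simp add: injective_open_imp_embedding_map)
qed

lemma dense_n_kappa: "n_kappa n X closure_of (Inl ` topspace X) = topspace (n_kappa n X)"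
proof -
  have *: "Inl x \<in> Inl ` topspace X" if "Inl x \<in> T" "openin (n_kappa n X) T" for x T
    using that Inl_in_n_kappa_points[of x n X] by (auto simp: openin_n_kappa)
  have "\<exists>y \<in> Inl ` topspace X. y \<in> T" if p: "p \<in> T" and T: "openin (n_kappa n X) T" for p T
  proof (cases p)
    case (Inl x)
    then show ?thesis using *[of x T] p T by auto
  next
    case (Inr q)
    obtain \<U> i where q: "p = Inr (\<U>, i)" using Inr by (cases q) auto
    then have "p \<in> n_kappa_points n X" "Inl -` T \<in> \<U>"
      using T p by (auto simp: openin_n_kappa)
    moreover from this q have "open_filter X \<U>"
      using small_ultrafilters_open_filter by (auto simp: Inr_in_n_kappa_points)
    ultimately have "Inl -` T \<noteq> {}" unfolding open_filter_def by simp
    then obtain x where "Inl x \<in> T" by auto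
    then show ?thesis using *[of x T] T by auto
  qed
  then show ?thesis by (auto simp: closure_of_def)
qed

end

theory Submission
  imports Defs
begin

text \<open>Call the points added for one ultrafilter \<open>\<U>\<close> the fibre of \<open>\<U>\<close>; it is finite. A continuous
  \<open>f\<close> fixing \<open>X\<close> that sends a point of the fibre of \<open>\<U>\<close> into the fibre of \<open>\<V>\<close> gives \<open>\<V> \<subseteq> \<U>\<close>, hence
  \<open>\<V> = \<U>\<close> by maximality. So a surjective \<open>f\<close> must cover each fibre by itself, and by finiteness
  it permutes the fibre. Thus \<open>f\<close> is a bijection, and it is open because neighbourhoods of an added
  point depend only on its fibre.\<close>

text \<open>Empty when \<open>\<U>\<close> is not in \<open>small_ultrafilters n X\<close>, so facts
  about fibres can be stated for every \<open>\<U>\<close>.\<close>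

definition kappa_fibre :: "nat \<Rightarrow> 'a topology \<Rightarrow> 'a set set \<Rightarrow> 'a kappa_point set" where
  "kappa_fibre n X \<U> = {p \<in> n_kappa_points n X. \<exists>i. p = Inr (\<U>, i)}"

lemma finite_kappa_fibre: "finite (kappa_fibre n X \<U>)"
proof (rule finite_subset)
  show "kappa_fibre n X \<U> \<subseteq> (\<lambda>i. Inr (\<U>, i)) ` {..n}"
    by (auto simp: kappa_fibre_def Inr_in_n_kappa_points)
qed simp

lemma n_kappa_points_cases:
  assumes "p \<in> n_kappa_points n X"
  obtains x where "x \<in> topspace X" "p = Inl x"
    | \<U> where "\<U> \<in> small_ultrafilters n X" "p \<in> kappa_fibre n X \<U>"
  using assms unfolding n_kappa_points_def kappa_fibre_def by blast

lemma open_ultrafilter_eqI: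
  assumes "open_ultrafilter X \<V>" "open_filter X \<U>" "\<V> \<subseteq> \<U>"
  shows "\<V> = \<U>"
  using assms unfolding open_ultrafilter_def by blast

text \<open>Since \<open>f\<close> fixes \<open>X\<close>, pulling back a neighbourhood of
  \<open>f p\<close> leaves its trace on \<open>X\<close> unchanged, and traces of neighbourhoods of
  \<open>p\<close> belong to \<open>\<U>\<close>.\<close>

lemma continuous_map_preserves_fibre:
  fixes f :: "'a kappa_point \<Rightarrow> 'a kappa_point"
  assumes f: "continuous_map (n_kappa n X) (n_kappa n X) f"
    and id: "\<And>x. x \<in> topspace X \<Longrightarrow> f (Inl x) = Inl x"
    and p: "p \<in> kappa_fibre n X \<U>" and fp: "f p \<in> kappa_fibre n X \<V>"
  shows "\<V> = \<U>"
proof (rule open_ultrafilter_eqI)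
  obtain i where i: "p = Inr (\<U>, i)" "Inr (\<U>, i) \<in> n_kappa_points n X"
    using p by (auto simp: kappa_fibre_def)
  obtain j where j: "f p = Inr (\<V>, j)" "Inr (\<V>, j) \<in> n_kappa_points n X"
    using fp by (auto simp: kappa_fibre_def)
  show V: "open_ultrafilter X \<V>"
    using j by (simp add: Inr_in_n_kappa_points small_ultrafilters_def)
  show "open_filter X \<U>"
    using i Inr_in_n_kappa_points small_ultrafilters_open_filter by blast
  show "\<V> \<subseteq> \<U>"
  proof
    fix W assume W: "W \<in> \<V>"
    then have opW: "openin X W"
      using V unfolding open_ultrafilter_def open_filter_def by blast
    \<comment> \<open>The smallest neighbourhood of \<open>f p\<close> with trace \<open>W\<close>:
      no other added point is included.\<close>
    define N :: "'a kappa_point set" where "N = insert (Inr (\<V>, j)) (Inl ` W)"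
    have trace_N: "Inl -` N = W"
      by (auto simp: N_def)
    have "openin (n_kappa n X) N"
      unfolding openin_n_kappa trace_N
      using j W opW openin_subset[OF opW] by (auto simp: N_def Inl_in_n_kappa_points)
    then have "openin (n_kappa n X) {q \<in> n_kappa_points n X. f q \<in> N}"
      using f unfolding continuous_map_def topspace_n_kappa by blast
    moreover have "Inr (\<U>, i) \<in> {q \<in> n_kappa_points n X. f q \<in> N}"
      using i j by (simp add: N_def)
    ultimately have "Inl -` {q \<in> n_kappa_points n X. f q \<in> N} \<in> \<U>"
      unfolding openin_n_kappa by blast
    moreover have "Inl -` {q \<in> n_kappa_points n X. f q \<in> N} = W"
      using openin_subset[OF opW] id by (auto simp: N_def Inl_in_n_kappa_points)
    ultimately show "W \<in> \<U>" by simp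
  qed
qed

text \<open>Surjectivity only shows that the image of the fibre covers the fibre; that
  \<open>f\<close> maps the fibre into itself, injectively, follows by counting.\<close>

lemma bij_betw_kappa_fibre:
  fixes f :: "'a kappa_point \<Rightarrow> 'a kappa_point"
  assumes f: "continuous_map (n_kappa n X) (n_kappa n X) f"
    and surj: "f ` topspace (n_kappa n X) = topspace (n_kappa n X)"
    and id: "\<And>x. x \<in> topspace X \<Longrightarrow> f (Inl x) = Inl x"
  shows "bij_betw f (kappa_fibre n X \<U>) (kappa_fibre n X \<U>)"
proof -
  \<comment> \<open>A preimage of \<open>p\<close> cannot lie in \<open>X\<close>, whose points are
    fixed, nor in the fibre of another ultrafilter.\<close>
  have sub: "kappa_fibre n X \<U> \<subseteq> f ` kappa_fibre n X \<U>"
  proof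
    fix p assume p: "p \<in> kappa_fibre n X \<U>"
    then have "p \<in> f ` n_kappa_points n X"
      using surj by (simp add: topspace_n_kappa kappa_fibre_def)
    then obtain q where q: "q \<in> n_kappa_points n X" "f q = p"
      by blast
    from q(1) show "p \<in> f ` kappa_fibre n X \<U>"
    proof (cases rule: n_kappa_points_cases)
      case (1 x)
      then show ?thesis using id q(2) p by (auto simp: kappa_fibre_def)
    next
      case (2 \<V>)
      have "\<U> = \<V>"
      proof (rule continuous_map_preserves_fibre[OF f id])
        show "q \<in> kappa_fibre n X \<V>" by (rule 2)
        show "f q \<in> kappa_fibre n X \<U>" using p q(2) by simp
      qed
      then show ?thesis using 2 q(2) by blast
    qed
  qed
  \<comment> \<open>An image has at most as many points as the finite fibre it comes from, so the
    inclusion \<open>sub\<close> is an equality.\<close>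
  have "card (f ` kappa_fibre n X \<U>) \<le> card (kappa_fibre n X \<U>)"
    by (simp add: card_image_le finite_kappa_fibre)
  then have eq: "f ` kappa_fibre n X \<U> = kappa_fibre n X \<U>"
    by (rule card_seteq[OF finite_imageI[OF finite_kappa_fibre] sub, symmetric])
  moreover have "inj_on f (kappa_fibre n X \<U>)"
    by (rule eq_card_imp_inj_on[OF finite_kappa_fibre]) (simp only: eq)
  ultimately show ?thesis by (simp add: bij_betw_def)
qed

theorem theorem6:
  fixes n :: nat and X :: "'a topology" and f :: "'a kappa_point \<Rightarrow> 'a kappa_point"
  assumes "n \<ge> 2"
    and "n_Hausdorff n X"
    and "continuous_map (n_kappa n X) (n_kappa n X) f"
    and "f ` topspace (n_kappa n X) = topspace (n_kappa n X)"
    and "\<And>x. x \<in> topspace X \<Longrightarrow> f (Inl x) = Inl x"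
  shows "homeomorphic_map (n_kappa n X) (n_kappa n X) f"
proof (rule bijective_open_imp_homeomorphic_map)
  note id = assms(5)
  note bij = bij_betw_kappa_fibre[OF assms(3,4,5)]
  have fibre: "f p \<in> kappa_fibre n X \<U>" if "p \<in> kappa_fibre n X \<U>" for p \<U>
    using bij_betw_apply[OF bij that] .
  have fibre_Inr: "\<exists>i. p = Inr (\<U>, i)" if "p \<in> kappa_fibre n X \<U>" for p \<U>
    using that by (simp add: kappa_fibre_def)
  \<comment> \<open>Excludes collisions between points of \<open>X\<close> and added points, here
    and in the trace computation for openness.\<close>
  have not_Inl: "f p \<noteq> Inl x" if "p \<in> kappa_fibre n X \<U>" for p x \<U>
    using fibre_Inr[OF fibre[OF that]] by auto
  show "continuous_map (n_kappa n X) (n_kappa n X) f"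
    and "f ` topspace (n_kappa n X) = topspace (n_kappa n X)"
    by (rule assms)+
  show "inj_on f (topspace (n_kappa n X))"
    unfolding topspace_n_kappa
  proof (rule inj_onI)
    fix p q assume p: "p \<in> n_kappa_points n X" and q: "q \<in> n_kappa_points n X" and eq: "f p = f q"
    show "p = q"
      using p
    proof (cases rule: n_kappa_points_cases)
      case p: (1 x)
      show ?thesis
        using q
      proof (cases rule: n_kappa_points_cases)
        case (1 y)
        then show ?thesis using p id eq by simp
      next
        case (2 \<V>)
        then show ?thesis using not_Inl[OF 2(2)] p id eq by metis
      qed
    next
      case p: (2 \<U>)
      show ?thesis
        using q
      proof (cases rule: n_kappa_points_cases)
        case (1 y)
        then show ?thesis using not_Inl[OF p(2), of y] id[of y] eq by simp
      next
        case (2 \<V>)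
        have "\<V> = \<U>"
          using fibre_Inr[OF fibre[OF p(2)]] fibre_Inr[OF fibre[OF 2(2)]] eq by auto
        then show ?thesis
          using inj_onD[OF bij_betw_imp_inj_on[OF bij] eq p(2)] 2(2) by blast
      qed
    qed
  qed
  show "open_map (n_kappa n X) (n_kappa n X) f"
    unfolding open_map_def
  proof (intro allI impI)
    fix V assume V: "openin (n_kappa n X) V"
    then have sub: "V \<subseteq> n_kappa_points n X" by (simp add: openin_n_kappa)
    \<comment> \<open>Openness depends only on the trace and on which fibres are met;
      \<open>f\<close> alters neither.\<close>
    have trace: "Inl -` (f ` V) = Inl -` V"
    proof (intro set_eqI iffI)
      fix x assume "x \<in> Inl -` (f ` V)"
      then obtain q where q: "q \<in> V" "f q = Inl x" by (metis imageE vimageD)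
      with sub have "q \<in> n_kappa_points n X" by blast
      then show "x \<in> Inl -` V"
      proof (cases rule: n_kappa_points_cases)
        case (1 y)
        then show ?thesis using q id by simp
      next
        case (2 \<U>)
        then show ?thesis using q(2) not_Inl[OF 2(2)] by simp
      qed
    next
      fix x assume "x \<in> Inl -` V"
      then show "x \<in> Inl -` (f ` V)"
        using sub id[of x] Inl_in_n_kappa_points[of x n X] by (metis imageI subsetD vimage_eq)
    qed
    show "openin (n_kappa n X) (f ` V)"
      unfolding openin_n_kappa trace
    proof (intro conjI allI impI)
      show "f ` V \<subseteq> n_kappa_points n X"
        using image_mono[OF sub, of f] assms(4) by (simp add: topspace_n_kappa)
      show "openin X (Inl -` V)" using V by (simp add: openin_n_kappa)
      fix \<U> i assume "Inr (\<U>, i) \<in> f ` V"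
      then obtain q where q: "q \<in> V" "f q = Inr (\<U>, i)" by (metis imageE)
      with sub have "q \<in> n_kappa_points n X" by blast
      then show "Inl -` V \<in> \<U>"
      proof (cases rule: n_kappa_points_cases)
        case (1 y)
        then show ?thesis using q id by simp
      next
        case (2 \<V>)
        \<comment> \<open>\<open>q\<close> lies in the same fibre as its image, so the openness
          condition of \<open>V\<close> at \<open>q\<close> is the one required.\<close>
        have "\<V> = \<U>" using q(2) fibre_Inr[OF fibre[OF 2(2)]] by auto
        then show ?thesis using fibre_Inr[OF 2(2)] q(1) V unfolding openin_n_kappa by blast
      qed
    qed
  qed
qed

end
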